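(* Let $p$ be a prime with $p\equiv1\pmod 4$ and $p\neq5$. Then for any integer $L$ satisfying $\frac{p-1}{2}\le L\le p-1$, the interval $\mathcal{I}=\{1,2,\ldots,L\}\pmod p$ admits a nontrivial multiplicative decomposition.
   Context: $\mathbb{F}_p$ is the field of residues modulo the prime $p$. For $\mathcal{A},\mathcal{B}\subset\mathbb{F}_p$, $\mathcal{A}\mathcal{B}=\{ab:\ a\in\mathcal{A},\ b\in\mathcal{B}\}$. A set $\mathcal{S}\subset\mathbb{F}_p$ is said to admit (have) a nontrivial multiplicative decomposition if $\mathcal{S}\setminus\{0\}=\mathcal{A}\mathcal{B}$ for some sets $\mathcal{A},\mathcal{B}\subset\mathbb{F}_p$ with $|\mathcal{A}|\ge2$ and $|\mathcal{B}|\ge2$. *)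

theory Defs
  imports "HOL-Number_Theory.Residues" "HOL-Algebra.Coset"
begin

abbreviation prime_field :: "nat \<Rightarrow> int ring" where
  "prime_field p \<equiv> residue_ring (int p)"

definition nontrivial_mult_decomp :: "nat \<Rightarrow> int set \<Rightarrow> bool" where
  "nontrivial_mult_decomp p S \<longleftrightarrow>
     (\<exists>A B. A \<subseteq> carrier (prime_field p) \<and> B \<subseteq> carrier (prime_field p) \<and>
            card A \<ge> 2 \<and> card B \<ge> 2 \<and>
            S - {\<zero>\<^bsub>prime_field p\<^esub>} = A <#>\<^bsub>prime_field p\<^esub> B)"

definition residue_interval :: "nat \<Rightarrow> int \<Rightarrow> int set" where
  "residue_interval p L = (\<lambda>x. x mod int p) ` {1..L}"

end

theory Submission
  imports Defs "HOL-Number_Theory.Euler_Criterion"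
begin

text \<open>Let \<open>i\<close> be a square root of \<open>-1\<close> modulo \<open>p\<close>. For every \<open>x\<close> not divisible by \<open>p\<close>,
  one of \<open>i x\<close> and \<open>i\<^sup>-\<^sup>1 x = - i x\<close> has its residue in \<open>{1..(p - 1) / 2}\<close>, hence in the interval \<open>S\<close>.
  So \<open>S = {1, i} B\<close> with \<open>B = {x \<in> S. i x \<in> S}\<close>, and \<open>|S| \<le> 2 |B|\<close> forces \<open>|B| \<ge> 2\<close>
  as soon as \<open>p > 5\<close>.\<close>

text \<open>Euler's criterion: \<open>(p - 1) div 2\<close> is even, so the Legendre symbol of
  \<open>-1\<close> is congruent to \<open>1\<close>.\<close>

lemma sqrt_minus_one_mod_prime:
  fixes p :: nat
  assumes "prime p" "[p = 1] (mod 4)"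
  obtains i :: int where "0 \<le> i" "i < int p" "[i\<^sup>2 = -1] (mod int p)"
proof -
  have "p mod 4 = 1" using assms(2) by (simp add: cong_def)
  moreover have "p > 1" using assms(1) prime_gt_1_nat by blast
  ultimately have p: "p > 2" "even ((p - 1) div 2)" by presburger+
  have "[Legendre (-1) (int p) = (-1) ^ ((p - 1) div 2)] (mod int p)"
    using euler_criterion[of p "-1"] assms(1) p(1) by simp
  then have L: "[Legendre (-1) (int p) = 1] (mod int p)"
    using p(2) by simp
  \<comment> \<open>These rule out the values \<open>0\<close> and \<open>-1\<close> of the Legendre
    symbol, since neither is congruent to \<open>1\<close> when \<open>p > 2\<close>.\<close>
  have "\<not> int p dvd -1" "\<not> int p dvd -1 - 1"
    using p(1) zdvd_not_zless[of 1 "int p"] zdvd_not_zless[of 2 "int p"] by auto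
  then have "QuadRes (int p) (-1)"
    using L by (auto simp: Legendre_def cong_iff_dvd_diff split: if_splits)
  then obtain y where y: "[y\<^sup>2 = -1] (mod int p)" by (auto simp: QuadRes_def)
  show ?thesis
    by (rule that[of "y mod int p"]) (use p(1) y in \<open>auto simp: cong_def power_mod\<close>)
qed

theorem theorem2:
  fixes p :: nat and L :: int
  assumes "prime p" and "[p = 1] (mod 4)" and "p \<noteq> 5"
    and "(real p - 1) / 2 \<le> real_of_int L" and "L \<le> int p - 1"
  shows "nontrivial_mult_decomp p (residue_interval p L)"
proof -
  have "p mod 4 = 1" using assms(2) by (simp add: cong_def)
  moreover have "p > 1" "p \<noteq> 9"
    using assms(1) prime_gt_1_nat by auto
  ultimately have p13: "p \<ge> 13" using assms(3) by presburger
  have "real_of_int (int p - 1) \<le> real_of_int (2 * L)" using assms(4) by simp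
  then have L2: "int p - 1 \<le> 2 * L" by (simp only: of_int_le_iff)
  interpret residues "int p" "prime_field p"
    by unfold_locales (use p13 in auto)
  obtain i :: int where i: "0 \<le> i" "i < int p" and sq: "[i\<^sup>2 = -1] (mod int p)"
    using sqrt_minus_one_mod_prime assms(1,2) by blast
  \<comment> \<open>Otherwise \<open>1 = -1\<close> modulo \<open>p\<close>, so \<open>p\<close>
    would divide \<open>2\<close>.\<close>
  have i1: "i \<noteq> 1"
    using sq p13 zdvd_not_zless[of 2 "int p"] by (auto simp: cong_iff_dvd_diff)
  define S where "S = {1..L}"
  have S: "residue_interval p L = S"
    using assms(5) unfolding residue_interval_def S_def by (auto simp: image_iff)
  define B where "B = {x \<in> S. i * x mod int p \<in> S}"
  define A where "A = {1, i}"
  have cover: "x \<in> B \<or> (\<exists>y\<in>B. x = i * y mod int p)" if x: "x \<in> S" for x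
  proof (cases "i * x mod int p \<in> S")
    case True
    then show ?thesis using x by (simp add: B_def)
  next
    case False
    define r where "r = i * x mod int p"
    have r: "0 \<le> r" "r < int p" using p13 by (auto simp: r_def)
    have "[i * r = i\<^sup>2 * x] (mod int p)"
      by (simp add: r_def cong_def mod_simps power2_eq_square mult.assoc)
    also have "[i\<^sup>2 * x = - x] (mod int p)"
      using cong_scalar_right[OF sq, of x] by simp
    finally have ir: "[i * r = - x] (mod int p)" .
    have xp: "x mod int p = x" using x assms(5) by (simp add: S_def)
    \<comment> \<open>If \<open>r = 0\<close>, then \<open>p\<close> divides \<open>x\<close>, but
      \<open>0 < x < p\<close>.\<close>
    have "r \<noteq> 0"
      using ir xp x by (auto simp: cong_iff_dvd_diff S_def)
    \<comment> \<open>The witness \<open>p - r\<close> represents \<open>- i x\<close>. As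
      \<open>r\<close> is nonzero and outside \<open>S\<close>, \<open>r > L\<close>, so
      \<open>p - r \<le> p - 1 - L \<le> L\<close>.\<close>
    then have y: "int p - r \<in> S"
      using False r L2 by (auto simp: S_def r_def)
    have "[i * (int p - r) = - (i * r)] (mod int p)"
      by (simp add: cong_iff_dvd_diff algebra_simps)
    also have "[- (i * r) = x] (mod int p)"
      using ir cong_minus_minus_iff[of "i * r" "- x" "int p"] by simp
    finally have "x = i * (int p - r) mod int p"
      using xp by (simp add: cong_def)
    then show ?thesis using x y by (auto simp: B_def)
  qed
  have dec: "S = B \<union> (\<lambda>y. i * y mod int p) ` B"
    using cover by (auto simp: B_def)
  have BS: "B \<subseteq> S" by (auto simp: B_def)
  then have finB: "finite B" by (rule finite_subset) (simp add: S_def)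
  have "nat L = card S" by (simp add: S_def)
  also have "\<dots> \<le> card B + card ((\<lambda>y. i * y mod int p) ` B)"
    by (subst dec) (rule card_Un_le)
  also have "\<dots> \<le> card B + card B"
    by (simp add: card_image_le finB)
  \<comment> \<open>From \<open>p \<ge> 13\<close> follows \<open>L \<ge> 6\<close>, and
    \<open>L \<le> 2 * card B\<close>.\<close>
  finally have cardB: "card B \<ge> 2" using L2 p13 by linarith
  have cardA: "card A \<ge> 2" using i1 by (simp add: A_def)
  have Bmod: "y mod int p = y" if "y \<in> B" for y
    using that BS assms(5) by (auto simp: S_def)
  have "S - {\<zero>\<^bsub>prime_field p\<^esub>} = A <#>\<^bsub>prime_field p\<^esub> B"
  proof -
    have "A <#>\<^bsub>prime_field p\<^esub> B = (\<lambda>y. y mod int p) ` B \<union> (\<lambda>y. i * y mod int p) ` B"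
      by (auto simp: set_mult_def A_def res_mult_eq)
    also have "\<dots> = S" using dec Bmod by simp
    \<comment> \<open>Removing zero changes nothing, since \<open>S\<close> starts at
      \<open>1\<close>.\<close>
    finally show ?thesis by (simp add: res_zero_eq S_def)
  qed
  moreover have "A \<subseteq> carrier (prime_field p)" "B \<subseteq> carrier (prime_field p)"
    using i p13 BS assms(5) by (auto simp: A_def S_def res_carrier_eq)
  ultimately show ?thesis
    using cardA cardB unfolding nontrivial_mult_decomp_def S by blast
qed

end
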